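(* Let $\xi_1,\dots,\xi_n$ be independent random variables with mean zero and finite second moments, and for each $i=1,\dots,n$ define $$\xi_{b,i}=\xi_iI(|\xi_i|\le1)+I(\xi_i>1)-I(\xi_i<-1).$$ Let $W=\sum_{i=1}^n\xi_i$ and $W_b=\sum_{i=1}^n\xi_{b,i}$, and let $\Delta_1$ and $\Delta_2$ be two random variables on the same probability space. Assume there exist $c_1>c_2>0$ and $\delta\in(0,1/2)$ such that $$\sum_{i=1}^n\mathbb{E}[\xi_i^2]\le c_1\qquad\text{and}\qquad\sum_{i=1}^n\mathbb{E}\big[|\xi_{b,i}|\min(\delta,|\xi_i|/2)\big]\ge c_2.$$ Then for any $\lambda\ge0$, $$\begin{aligned} \mathbb{E}\big[e^{\lambda W_b}I(\Delta_1\le W_b\le\Delta_2)\big]\le{}&\big(\mathbb{E}[e^{2\lambda W_b}]\big)^{1/2}\exp\Big(-\frac{c_2^2}{16c_1\delta^2}\Big)\\ &+\frac{2e^{\lambda\delta}}{c_2}\Bigg\{\sum_{i=1}^n\mathbb{E}\Big[|\xi_{b,i}|e^{\lambda W_b^{(i)}}\big(|\Delta_1-\Delta_1^{(i)}|+|\Delta_2-\Delta_2^{(i)}|\big)\Big]\\ &+\mathbb{E}\big[|W_b|e^{\lambda W_b}(|\Delta_2-\Delta_1|+2\delta)\big]+\sum_{i=1}^n\big|\mathbb{E}[\xi_{b,i}]\big|\,\mathbb{E}\big[e^{\lambda W_b^{(i)}}(|\Delta_2^{(i)}-\Delta_1^{(i)}|+2\delta)\big]\Bigg\}, \end{aligned}$$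 where $W^{(i)}=W-\xi_i$, $W_b^{(i)}=W_b-\xi_{b,i}$, and $\Delta_1^{(i)},\Delta_2^{(i)}$ are any random variables on the same probability space such that $\xi_i$ and $(\Delta_1^{(i)},\Delta_2^{(i)},W^{(i)},W_b^{(i)})$ are independent, for each $i$. In particular, with $\beta_2=\sum_{i=1}^n\mathbb{E}[\xi_i^2I(|\xi_i|>1)]$ and $\beta_3=\sum_{i=1}^n\mathbb{E}[|\xi_i|^3I(|\xi_i|\le1)]$, if $\sum_{i=1}^n\mathbb{E}[\xi_i^2]=1$ and $\beta_2+\beta_3\le1/2$, then the choice $$\delta=\frac{\beta_2+\beta_3}{4},\qquad c_1=1,\qquad c_2=\frac14$$ satisfies $c_1>c_2>0$, $\delta\in(0,1/2)$, $\sum_{i=1}^n\mathbb{E}[\xi_i^2]\le c_1$ and $\sum_{i=1}^n\mathbb{E}\big[|\xi_{b,i}|\min(\delta,|\xi_i|/2)\big]\ge c_2$.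
   Context: $I(\cdot)$ denotes the indicator function. All random variables are real-valued. *)

theory Defs
  imports "HOL-Probability.Probability"
begin

definition trunc1 :: "real \<Rightarrow> real" where
  "trunc1 x = x * of_bool (\<bar>x\<bar> \<le> 1) + of_bool (x > 1) - of_bool (x < - 1)"

text \<open>
  The expectation of a nonnegative random variable that need not be integrable. It takes values
  in \<open>[0, \<infinity>]\<close>, whereas the Bochner integral would silently be \<open>0\<close> in the non-integrable case.
\<close>
definition nn_expectation :: "'a measure \<Rightarrow> ('a \<Rightarrow> real) \<Rightarrow> ennreal" where
  "nn_expectation M X = (\<integral>\<^sup>+ \<omega>. ennreal (X \<omega>) \<partial>M)"

text \<open>
  The library's \<open>indep_var\<close> only relates random variables with the same codomain type. Here a
  real-valued variable must be independent of a tuple-valued one.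
\<close>
definition indep_rv ::
  "'a measure \<Rightarrow> 'b measure \<Rightarrow> ('a \<Rightarrow> 'b) \<Rightarrow> 'c measure \<Rightarrow> ('a \<Rightarrow> 'c) \<Rightarrow> bool" where
  "indep_rv M N X K Y \<longleftrightarrow>
     X \<in> measurable M N \<and> Y \<in> measurable M K \<and>
     prob_space.indep_set M {X -` A \<inter> space M | A. A \<in> sets N} {Y -` B \<inter> space M | B. B \<in> sets K}"

lemma indep_rv_iff_indep_var:
  assumes "prob_space M"
  shows "indep_rv M N X K Y \<longleftrightarrow> prob_space.indep_var M N X K Y"
proof -
  interpret prob_space M by fact
  have eq: "sigma_sets (space M) {Z -` A \<inter> space M | A. A \<in> sets L} = {Z -` A \<inter> space M | A. A \<in> sets L}"
    if "Z \<in> measurable M L" for Z :: "'a \<Rightarrow> 'b" and L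
  proof -
    have "Z \<in> space M \<rightarrow> space L" using that by (simp add: measurable_def)
    then have "sets (vimage_algebra (space M) Z L) = {Z -` A \<inter> space M | A. A \<in> sets L}"
      by (rule sets_vimage_algebra2)
    then show ?thesis by (metis sets.sigma_sets_eq space_vimage_algebra)
  qed
  show ?thesis
    unfolding indep_rv_def indep_var_eq using eq[of X N] eq[of Y K] by auto
qed

end

theory Submission
  imports Defs
begin

text \<open>
  Stein's method with the test function \<open>f(w) = exp(\<lambda>w) max(0, min(w - a + \<delta>, b - a + 2\<delta>))\<close>, which is
  nondecreasing, vanishes below \<open>a - \<delta>\<close> and has slope at least \<open>exp(\<lambda>w)\<close> on \<open>[a - \<delta>, b + \<delta>]\<close>. Hence
  \<open>x (f(w) - f(w - x)) \<ge> |x| min(\<delta>, |x|) exp(\<lambda>(w - \<delta>))\<close> for \<open>a \<le> w \<le> b\<close>. Summing this over the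
  truncated variables and expanding \<open>E[W\<^sub>b f(W\<^sub>b)]\<close> by independence bounds \<open>E[exp(\<lambda>W\<^sub>b) I(a \<le> W\<^sub>b \<le> b) U]\<close>,
  where \<open>U\<close> is the sum of the variables whose total mean is at least \<open>c\<^sub>2\<close>. A lower-tail bound for sums
  of nonnegative independent variables makes \<open>U \<le> c\<^sub>2/2\<close> exponentially unlikely, and Cauchy--Schwarz
  controls that part.

  Integrability is never an issue: since \<open>|W\<^sub>b| \<le> n\<close>, the pairs \<open>\<Delta>\<^sub>1, \<Delta>\<^sub>2\<close> and their primed versions may
  be sorted and clamped to \<open>[-n, n]\<close>. This can only enlarge the event, and it increases no term of the
  right-hand side.
\<close>

section \<open>Lower tails of nonnegative sums and a Cauchy--Schwarz bound\<close>

text \<open>The gap between the two sides vanishes at 0 and has derivative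
  \<open>- 1 + y + exp (- y)\<close>, which is nonnegative because
  \<open>1 + z \<le> exp z\<close>.\<close>

lemma exp_minus_le_quadratic:
  fixes x :: real
  assumes "0 \<le> x"
  shows "exp (- x) \<le> 1 - x + x\<^sup>2 / 2"
proof -
  let ?g = "\<lambda>x::real. 1 - x + x\<^sup>2 / 2 - exp (- x)"
  have "?g 0 \<le> ?g x"
  proof (rule DERIV_nonneg_imp_nondecreasing[OF assms])
    fix y :: real
    have "(?g has_real_derivative (- 1 + y + exp (- y))) (at y)"
      by (auto intro!: derivative_eq_intros)
    moreover have "0 \<le> - 1 + y + exp (- y)"
      using exp_ge_add_one_self[of "- y"] by simp
    ultimately show "\<exists>d. (?g has_real_derivative d) (at y) \<and> 0 \<le> d"
      by blast
  qed
  then show ?thesis by simp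
qed

text \<open>Chernoff bound. Since \<open>Y i\<close> and \<open>t\<close> are nonnegative, the
  quadratic bound on \<open>exp (- t * Y i \<omega>)\<close> holds at every point, so first and
  second moments control the moment generating function.\<close>

lemma (in prob_space) lower_tail_sum_nonneg_indep:
  fixes Y :: "'i \<Rightarrow> 'a \<Rightarrow> real"
  assumes "finite I" and indep: "indep_vars (\<lambda>_. borel) Y I"
    and nonneg: "\<And>i \<omega>. i \<in> I \<Longrightarrow> 0 \<le> Y i \<omega>"
    and sq: "\<And>i. i \<in> I \<Longrightarrow> integrable M (\<lambda>\<omega>. (Y i \<omega>)\<^sup>2)"
    and V: "0 < V" "(\<Sum>i\<in>I. expectation (\<lambda>\<omega>. (Y i \<omega>)\<^sup>2)) \<le> V"
    and "0 \<le> s"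
  shows "prob {\<omega> \<in> space M. (\<Sum>i\<in>I. Y i \<omega>) \<le> (\<Sum>i\<in>I. expectation (Y i)) - s} \<le> exp (- (s\<^sup>2 / (2 * V)))"
proof -
  \<comment> \<open>This \<open>t\<close> minimises the final exponent
    \<open>t\<^sup>2 / 2 * V - t * s\<close>; the minimum is
    \<open>- (s\<^sup>2 / (2 * V))\<close>.\<close>
  define t where "t = s / V"
  define m where "m = (\<Sum>i\<in>I. expectation (Y i))"
  have "0 \<le> t"
    using V \<open>0 \<le> s\<close> by (simp add: t_def)
  have meas [measurable]: "Y i \<in> borel_measurable M" if "i \<in> I" for i
    using indep that by (auto simp: indep_vars_def)
  have int: "integrable M (Y i)" if "i \<in> I" for i
    using square_integrable_imp_integrable[OF meas[OF that] sq[OF that]] .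
  have int_exp: "integrable M (\<lambda>\<omega>. exp (- t * Y i \<omega>))" if "i \<in> I" for i
    using that nonneg[OF that] \<open>0 \<le> t\<close> by (intro integrable_const_bound[of _ 1]) auto
  have indep_exp: "indep_vars (\<lambda>_. borel) (\<lambda>i \<omega>. exp (- t * Y i \<omega>)) I"
    by (rule indep_vars_compose2[OF indep]) auto
  have mgf: "expectation (\<lambda>\<omega>. exp (- t * Y i \<omega>))
      \<le> exp (- t * expectation (Y i) + t\<^sup>2 / 2 * expectation (\<lambda>\<omega>. (Y i \<omega>)\<^sup>2))" if "i \<in> I" for i
  proof -
    have "expectation (\<lambda>\<omega>. exp (- t * Y i \<omega>))
        \<le> expectation (\<lambda>\<omega>. 1 - t * Y i \<omega> + t\<^sup>2 / 2 * (Y i \<omega>)\<^sup>2)"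
    proof (rule integral_mono)
      show "integrable M (\<lambda>\<omega>. 1 - t * Y i \<omega> + t\<^sup>2 / 2 * (Y i \<omega>)\<^sup>2)"
        using int[OF that] sq[OF that] by auto
      show "exp (- t * Y i \<omega>) \<le> 1 - t * Y i \<omega> + t\<^sup>2 / 2 * (Y i \<omega>)\<^sup>2" for \<omega>
        using exp_minus_le_quadratic[of "t * Y i \<omega>"] nonneg[OF that, of \<omega>] \<open>0 \<le> t\<close>
        by (simp add: power_mult_distrib)
    qed (use int_exp that in auto)
    also have "\<dots> = 1 + (- t * expectation (Y i) + t\<^sup>2 / 2 * expectation (\<lambda>\<omega>. (Y i \<omega>)\<^sup>2))"
      using int[OF that] sq[OF that] by (simp add: prob_space)
    \<comment> \<open>In exponential form the product over the independent factors becomes a sum in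
      the exponent.\<close>
    also have "\<dots> \<le> exp (- t * expectation (Y i) + t\<^sup>2 / 2 * expectation (\<lambda>\<omega>. (Y i \<omega>)\<^sup>2))"
      by (rule exp_ge_add_one_self)
    finally show ?thesis .
  qed
  have eq: "(\<lambda>\<omega>. exp (- t * (\<Sum>i\<in>I. Y i \<omega>))) = (\<lambda>\<omega>. \<Prod>i\<in>I. exp (- t * Y i \<omega>))"
    using \<open>finite I\<close> by (auto simp: sum_distrib_left exp_sum)
  have int_prod: "integrable M (\<lambda>\<omega>. exp (- t * (\<Sum>i\<in>I. Y i \<omega>)))"
    unfolding eq using indep_vars_integrable[OF \<open>finite I\<close> indep_exp int_exp] by simp
  have "expectation (\<lambda>\<omega>. exp (- t * (\<Sum>i\<in>I. Y i \<omega>))) = (\<Prod>i\<in>I. expectation (\<lambda>\<omega>. exp (- t * Y i \<omega>)))"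
    unfolding eq using indep_vars_lebesgue_integral[OF \<open>finite I\<close> indep_exp int_exp] by simp
  also have "\<dots> \<le> (\<Prod>i\<in>I. exp (- t * expectation (Y i) + t\<^sup>2 / 2 * expectation (\<lambda>\<omega>. (Y i \<omega>)\<^sup>2)))"
    using mgf by (intro prod_mono) auto
  also have "\<dots> = exp (- t * m + t\<^sup>2 / 2 * (\<Sum>i\<in>I. expectation (\<lambda>\<omega>. (Y i \<omega>)\<^sup>2)))"
    using \<open>finite I\<close> by (simp add: exp_sum[symmetric] sum.distrib sum_distrib_left m_def sum_negf sum_subtractf)
  also have "\<dots> \<le> exp (- t * m + t\<^sup>2 / 2 * V)"
    using V by (auto intro!: mult_left_mono)
  finally have mgf_sum: "expectation (\<lambda>\<omega>. exp (- t * (\<Sum>i\<in>I. Y i \<omega>))) \<le> exp (- t * m + t\<^sup>2 / 2 * V)" .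
  \<comment> \<open>As \<open>0 \<le> t\<close>, the lower-tail event lies in an upper-tail event of
    a positive variable, to which Markov's inequality applies.\<close>
  have "prob {\<omega> \<in> space M. (\<Sum>i\<in>I. Y i \<omega>) \<le> m - s}
      \<le> prob {\<omega> \<in> space M. exp (- t * (m - s)) \<le> exp (- t * (\<Sum>i\<in>I. Y i \<omega>))}"
    using \<open>0 \<le> t\<close> by (intro finite_measure_mono) (auto intro: mult_left_mono)
  also have "\<dots> \<le> expectation (\<lambda>\<omega>. exp (- t * (\<Sum>i\<in>I. Y i \<omega>))) / exp (- t * (m - s))"
    by (rule integral_Markov_inequality_measure[OF int_prod sets.empty_sets]) auto
  also have "\<dots> \<le> exp (- t * m + t\<^sup>2 / 2 * V) / exp (- t * (m - s))"
    by (rule divide_right_mono[OF mgf_sum]) simp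
  also have "\<dots> = exp (- (s\<^sup>2 / (2 * V)))"
    using V by (simp add: exp_diff[symmetric] t_def field_simps power2_eq_square)
  finally show ?thesis by (simp add: m_def)
qed

text \<open>Proved through the weighted inequality
  \<open>F \<le> F\<^sup>2 * q / (2 * e) + e / (2 * q)\<close>, with the weight \<open>e\<close>
  taken down to the root of the second moment. Bounding the probability by a square lets an
  exponential tail bound be inserted without a root.\<close>

lemma (in prob_space) expectation_indicator_le_Cauchy_Schwarz:
  fixes F :: "'a \<Rightarrow> real"
  assumes F: "F \<in> borel_measurable M" "integrable M (\<lambda>\<omega>. (F \<omega>)\<^sup>2)"
    and A: "A \<in> events" "prob A \<le> q\<^sup>2" and "0 < q"
  shows "expectation (\<lambda>\<omega>. F \<omega> * indicator A \<omega>) \<le> sqrt (expectation (\<lambda>\<omega>. (F \<omega>)\<^sup>2)) * q"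
proof -
  define E where "E = expectation (\<lambda>\<omega>. (F \<omega>)\<^sup>2)"
  have "0 \<le> E"
    by (simp add: E_def)
  have *: "expectation (\<lambda>\<omega>. F \<omega> * indicator A \<omega>) \<le> q * e" if "sqrt E \<le> e" "0 < e" for e
  proof -
    have "expectation (\<lambda>\<omega>. F \<omega> * indicator A \<omega>)
        \<le> expectation (\<lambda>\<omega>. (F \<omega>)\<^sup>2 * (q / (2 * e)) + indicator A \<omega> * (e / (2 * q)))"
    proof (rule integral_mono)
      show "integrable M (\<lambda>\<omega>. F \<omega> * indicator A \<omega>)"
        using square_integrable_imp_integrable[OF F] A by (simp add: integrable_real_mult_indicator)
      show "F \<omega> * indicator A \<omega> \<le> (F \<omega>)\<^sup>2 * (q / (2 * e)) + indicator A \<omega> * (e / (2 * q))" for \<omega>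
      proof -
        \<comment> \<open>Expanding this square gives the inequality on \<open>A\<close>; off
          \<open>A\<close> the left side is 0.\<close>
        have "0 \<le> (F \<omega> * q - e)\<^sup>2 / (2 * e * q)"
          using \<open>0 < q\<close> \<open>0 < e\<close> by simp
        also have "\<dots> = (F \<omega>)\<^sup>2 * (q / (2 * e)) + e / (2 * q) - F \<omega>"
          using \<open>0 < q\<close> \<open>0 < e\<close> by (simp add: field_simps power2_eq_square)
        finally show ?thesis
          using \<open>0 < q\<close> \<open>0 < e\<close> by (auto simp: indicator_def)
      qed
    qed (use F A in \<open>auto simp: integrable_real_mult_indicator less_top[symmetric]\<close>)
    also have "\<dots> = E * (q / (2 * e)) + prob A * (e / (2 * q))"
      using F A by (simp add: E_def less_top[symmetric])
    also have "\<dots> \<le> e\<^sup>2 * (q / (2 * e)) + q\<^sup>2 * (e / (2 * q))"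
      using \<open>0 < q\<close> \<open>0 < e\<close> A that(1)
      by (intro add_mono mult_right_mono) (auto dest: sqrt_le_D)
    also have "\<dots> = q * e"
      using \<open>0 < q\<close> \<open>0 < e\<close> by (simp add: field_simps power2_eq_square)
    finally show ?thesis .
  qed
  \<comment> \<open>\<open>E\<close> may be 0 while \<open>e\<close> is a denominator, so only
    \<open>e\<close> strictly above \<open>sqrt E\<close> is used, followed by a limit.\<close>
  have "expectation (\<lambda>\<omega>. F \<omega> * indicator A \<omega>) / q \<le> sqrt E"
  proof (rule dense_ge)
    fix e assume "sqrt E < e"
    moreover from this have "0 < e"
      using \<open>0 \<le> E\<close> real_sqrt_ge_zero[of E] by linarith
    ultimately show "expectation (\<lambda>\<omega>. F \<omega> * indicator A \<omega>) / q \<le> e"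
      using *[of e] \<open>0 < q\<close> by (simp add: field_simps)
  qed
  then show ?thesis
    using \<open>0 < q\<close> by (simp add: E_def field_simps)
qed

section \<open>The test function\<close>

definition ramp :: "real \<Rightarrow> real \<Rightarrow> real \<Rightarrow> real \<Rightarrow> real \<Rightarrow> real" where
  "ramp \<delta> l a b w = exp (l * w) * max 0 (min (w - a + \<delta>) (b - a + 2 * \<delta>))"

lemma ramp_nonneg: "0 \<le> ramp \<delta> l a b w"
  by (simp add: ramp_def)

lemma ramp_le:
  assumes "a \<le> b" "0 \<le> \<delta>"
  shows "ramp \<delta> l a b w \<le> exp (l * w) * (b - a + 2 * \<delta>)"
  unfolding ramp_def using assms by (intro mult_left_mono) auto

text \<open>The weight is common to both terms. The two arguments of \<open>min\<close> move by at
  most \<open>\<bar>a - a'\<bar> + \<bar>b - b'\<bar>\<close>, and \<open>min\<close> and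
  \<open>max\<close> do not enlarge this. It is the price of exchanging the endpoints for their
  primed versions.\<close>

lemma ramp_diff_le:
  "\<bar>ramp \<delta> l a b w - ramp \<delta> l a' b' w\<bar> \<le> exp (l * w) * (\<bar>a - a'\<bar> + \<bar>b - b'\<bar>)"
proof -
  let ?p = "max 0 (min (w - a + \<delta>) (b - a + 2 * \<delta>))" and ?q = "max 0 (min (w - a' + \<delta>) (b' - a' + 2 * \<delta>))"
  have "\<bar>ramp \<delta> l a b w - ramp \<delta> l a' b' w\<bar> = exp (l * w) * \<bar>?p - ?q\<bar>"
    by (simp add: ramp_def abs_mult right_diff_distrib[symmetric])
  also have "\<dots> \<le> exp (l * w) * (\<bar>a - a'\<bar> + \<bar>b - b'\<bar>)"
    by (intro mult_left_mono) (auto simp: max_def min_def)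
  finally show ?thesis .
qed

lemma mono_ramp:
  assumes "0 \<le> l" "v \<le> w"
  shows "ramp \<delta> l a b v \<le> ramp \<delta> l a b w"
  unfolding ramp_def using assms by (intro mult_mono) (auto intro: mult_left_mono)

text \<open>On the band from \<open>a - \<delta>\<close> to \<open>b + \<delta>\<close> the second
  factor is linear with slope 1. Lowering the weight at \<open>w + s\<close> to the one at
  \<open>w\<close> leaves exactly \<open>exp (l * w) * s\<close>.\<close>

lemma ramp_increment:
  assumes "0 \<le> l" "a - \<delta> \<le> w" "w + s \<le> b + \<delta>" "0 \<le> s" "a - \<delta> \<le> b + \<delta>"
  shows "exp (l * w) * s \<le> ramp \<delta> l a b (w + s) - ramp \<delta> l a b w"
proof -
  have "exp (l * w) * (w + s - a + \<delta>) \<le> exp (l * (w + s)) * (w + s - a + \<delta>)"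
    using assms by (intro mult_right_mono) (auto simp: mult_left_mono)
  moreover have "ramp \<delta> l a b (w + s) = exp (l * (w + s)) * (w + s - a + \<delta>)"
    "ramp \<delta> l a b w = exp (l * w) * (w - a + \<delta>)"
    using assms by (auto simp: ramp_def)
  ultimately show ?thesis
    by (simp add: algebra_simps)
qed

text \<open>A shift by \<open>x\<close> may leave the band on which the slope is controlled, so only
  its part of length \<open>s = min \<delta> \<bar>x\<bar>\<close> is counted; monotonicity discards
  the rest.\<close>

lemma ramp_increment_mult_ge:
  assumes "0 \<le> l" "0 \<le> \<delta>"
  shows "exp (l * (w - \<delta>)) * of_bool (a \<le> w \<and> w \<le> b) * (\<bar>x\<bar> * min \<delta> \<bar>x\<bar>)
    \<le> x * (ramp \<delta> l a b w - ramp \<delta> l a b (w - x))"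
proof -
  define s where "s = min \<delta> \<bar>x\<bar>"
  let ?f = "ramp \<delta> l a b"
  have s: "0 \<le> s" "s \<le> \<delta>" "s \<le> \<bar>x\<bar>"
    using assms by (auto simp: s_def)
  \<comment> \<open>By monotonicity the increment has the sign of \<open>x\<close>. This also
    settles the case where the event fails.\<close>
  have sgn: "x * (?f w - ?f (w - x)) = \<bar>x\<bar> * \<bar>?f w - ?f (w - x)\<bar>"
    using mono_ramp[OF assms(1), of w "w - x" \<delta> a b] mono_ramp[OF assms(1), of "w - x" w \<delta> a b]
    by (cases "0 \<le> x") (auto simp: abs_if algebra_simps)
  show ?thesis
  proof (cases "a \<le> w \<and> w \<le> b")
    case True
    have "exp (l * (w - \<delta>)) * s \<le> \<bar>?f w - ?f (w - x)\<bar>"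
    proof (cases "0 \<le> x")
      case nonneg: True
      \<comment> \<open>The increment starts at \<open>w - s\<close>, to the left of
        \<open>w\<close>; this is where the loss of \<open>\<delta>\<close> in the exponent comes
        from.\<close>
      have "exp (l * (w - \<delta>)) * s \<le> exp (l * (w - s)) * s"
        using s assms by (intro mult_right_mono) (auto intro: mult_left_mono)
      also have "\<dots> \<le> ?f w - ?f (w - s)"
        using ramp_increment[of l a \<delta> "w - s" s b] True s assms by auto
      also have "\<dots> \<le> ?f w - ?f (w - x)"
        using s nonneg assms by (intro diff_left_mono mono_ramp) auto
      finally show ?thesis by simp
    next
      case neg: False
      \<comment> \<open>For negative \<open>x\<close> the increment starts at \<open>w\<close>; the
        weight is lowered only to match the other sign.\<close>
      have "exp (l * (w - \<delta>)) * s \<le> exp (l * w) * s"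
        using s assms by (intro mult_right_mono) (auto intro: mult_left_mono)
      also have "\<dots> \<le> ?f (w + s) - ?f w"
        using ramp_increment[of l a \<delta> w s b] True s assms by auto
      also have "\<dots> \<le> ?f (w - x) - ?f w"
        using s neg assms by (intro diff_right_mono mono_ramp) auto
      finally show ?thesis by simp
    qed
    then have "\<bar>x\<bar> * (exp (l * (w - \<delta>)) * s) \<le> \<bar>x\<bar> * \<bar>?f w - ?f (w - x)\<bar>"
      by (rule mult_left_mono) simp
    then show ?thesis
      using True unfolding sgn s_def by (simp add: mult_ac)
  next
    case False
    then show ?thesis unfolding sgn by auto
  qed
qed

section \<open>Bounded random variables\<close>

text \<open>Unlike integrability, this property is stable under products and exponentials, so the
  integrability of composite expressions follows from their shape.\<close>

definition bdd_rv :: "'a measure \<Rightarrow> ('a \<Rightarrow> real) \<Rightarrow> bool" where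
  "bdd_rv M f \<longleftrightarrow> f \<in> borel_measurable M \<and> (\<exists>B. \<forall>\<omega>\<in>space M. \<bar>f \<omega>\<bar> \<le> B)"

lemma bdd_rvI:
  assumes "f \<in> borel_measurable M" "\<And>\<omega>. \<omega> \<in> space M \<Longrightarrow> \<bar>f \<omega>\<bar> \<le> B"
  shows "bdd_rv M f"
  using assms by (auto simp: bdd_rv_def)

lemma bdd_rv_measurable: "bdd_rv M f \<Longrightarrow> f \<in> borel_measurable M"
  by (simp add: bdd_rv_def)

lemma (in prob_space) integrable_bdd_rv: "bdd_rv M f \<Longrightarrow> integrable M f"
  unfolding bdd_rv_def using integrable_const_bound[of f] by auto

lemma bdd_rv_const: "bdd_rv M (\<lambda>_. c)"
  by (rule bdd_rvI[of _ _ "\<bar>c\<bar>"]) auto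

lemma bdd_rv_add:
  assumes "bdd_rv M f" "bdd_rv M g"
  shows "bdd_rv M (\<lambda>\<omega>. f \<omega> + g \<omega>)"
proof -
  have [measurable]: "f \<in> borel_measurable M" "g \<in> borel_measurable M"
    using assms by (auto simp: bdd_rv_def)
  obtain B C where "\<And>\<omega>. \<omega> \<in> space M \<Longrightarrow> \<bar>f \<omega>\<bar> \<le> B" "\<And>\<omega>. \<omega> \<in> space M \<Longrightarrow> \<bar>g \<omega>\<bar> \<le> C"
    using assms by (auto simp: bdd_rv_def)
  then show ?thesis
    using assms by (intro bdd_rvI[of _ _ "B + C"])
      (auto intro: order_trans[OF abs_triangle_ineq] add_mono)
qed

lemma bdd_rv_mult:
  assumes "bdd_rv M f" "bdd_rv M g"
  shows "bdd_rv M (\<lambda>\<omega>. f \<omega> * g \<omega>)"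
proof -
  have [measurable]: "f \<in> borel_measurable M" "g \<in> borel_measurable M"
    using assms by (auto simp: bdd_rv_def)
  obtain B C where "\<And>\<omega>. \<omega> \<in> space M \<Longrightarrow> \<bar>f \<omega>\<bar> \<le> B" "\<And>\<omega>. \<omega> \<in> space M \<Longrightarrow> \<bar>g \<omega>\<bar> \<le> C"
    using assms by (auto simp: bdd_rv_def)
  then show ?thesis
    using assms by (intro bdd_rvI[of _ _ "B * C"])
      (auto simp: abs_mult intro!: mult_mono order_trans[OF abs_ge_zero])
qed

lemma bdd_rv_minus: "bdd_rv M f \<Longrightarrow> bdd_rv M (\<lambda>\<omega>. - f \<omega>)"
  by (simp add: bdd_rv_def)

lemma bdd_rv_diff: "bdd_rv M f \<Longrightarrow> bdd_rv M g \<Longrightarrow> bdd_rv M (\<lambda>\<omega>. f \<omega> - g \<omega>)"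
  using bdd_rv_add[of M f "\<lambda>\<omega>. - g \<omega>"] bdd_rv_minus[of M g] by simp

lemma bdd_rv_abs: "bdd_rv M f \<Longrightarrow> bdd_rv M (\<lambda>\<omega>. \<bar>f \<omega>\<bar>)"
  by (auto simp: bdd_rv_def)

lemma bdd_rv_max:
  assumes "bdd_rv M f" "bdd_rv M g"
  shows "bdd_rv M (\<lambda>\<omega>. max (f \<omega>) (g \<omega>))"
proof -
  have eq: "(\<lambda>\<omega>. max (f \<omega>) (g \<omega>)) = (\<lambda>\<omega>. (f \<omega> + g \<omega> + \<bar>f \<omega> - g \<omega>\<bar>) * (1 / 2))"
    by (auto simp: max_def)
  show ?thesis
    unfolding eq using assms by (intro bdd_rv_const bdd_rv_add bdd_rv_mult bdd_rv_diff bdd_rv_abs)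
qed

lemma bdd_rv_min: "bdd_rv M f \<Longrightarrow> bdd_rv M g \<Longrightarrow> bdd_rv M (\<lambda>\<omega>. min (f \<omega>) (g \<omega>))"
  using bdd_rv_minus[OF bdd_rv_max[OF bdd_rv_minus bdd_rv_minus], of M f g]
  by (simp add: minus_max_eq_min)

lemma bdd_rv_exp:
  assumes "bdd_rv M f"
  shows "bdd_rv M (\<lambda>\<omega>. exp (f \<omega>))"
proof -
  obtain B where "\<And>\<omega>. \<omega> \<in> space M \<Longrightarrow> \<bar>f \<omega>\<bar> \<le> B"
    using assms by (auto simp: bdd_rv_def)
  then show ?thesis
    using assms by (intro bdd_rvI[of _ _ "exp B"]) (auto dest: bdd_rv_measurable abs_le_D1)
qed

lemma bdd_rv_sum: "(\<And>i. i \<in> I \<Longrightarrow> bdd_rv M (f i)) \<Longrightarrow> bdd_rv M (\<lambda>\<omega>. \<Sum>i\<in>I. f i \<omega>)"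
  by (induction I rule: infinite_finite_induct) (auto intro: bdd_rv_const bdd_rv_add)

lemma bdd_rv_of_bool_between:
  fixes f g h :: "'a \<Rightarrow> real"
  assumes [measurable]: "f \<in> borel_measurable M" "g \<in> borel_measurable M" "h \<in> borel_measurable M"
  shows "bdd_rv M (\<lambda>\<omega>. of_bool (f \<omega> \<le> g \<omega> \<and> g \<omega> \<le> h \<omega>))"
proof (rule bdd_rvI[of _ _ 1])
  have "(\<lambda>\<omega>. indicator {\<omega> \<in> space M. f \<omega> \<le> g \<omega> \<and> g \<omega> \<le> h \<omega>} \<omega> :: real) \<in> borel_measurable M"
    by measurable
  then show "(\<lambda>\<omega>. of_bool (f \<omega> \<le> g \<omega> \<and> g \<omega> \<le> h \<omega>) :: real) \<in> borel_measurable M"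
    by (rule measurable_cong[THEN iffD1, rotated]) (auto simp: indicator_def)
qed auto

lemmas bdd_rv_intros = bdd_rv_const bdd_rv_add bdd_rv_mult bdd_rv_minus bdd_rv_diff bdd_rv_abs
  bdd_rv_max bdd_rv_min bdd_rv_exp bdd_rv_sum bdd_rv_of_bool_between bdd_rv_measurable

lemma bdd_rv_ramp:
  "bdd_rv M a \<Longrightarrow> bdd_rv M b \<Longrightarrow> bdd_rv M w \<Longrightarrow> bdd_rv M (\<lambda>\<omega>. ramp \<delta> l (a \<omega>) (b \<omega>) (w \<omega>))"
  unfolding ramp_def by (intro bdd_rv_intros)

section \<open>Stein's argument for bounded endpoints\<close>

text \<open>The right-hand groups are the error of exchanging endpoints, the term
  \<open>S * f S\<close>, and the bias left by truncation. Independence enters as the factorisation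
  \<open>indep\<close>, for the test function with primed endpoints.\<close>

lemma (in prob_space) ramp_test_bound:
  fixes I :: "'i set" and X :: "'i \<Rightarrow> 'a \<Rightarrow> real" and a b :: "'a \<Rightarrow> real" and a' b' :: "'i \<Rightarrow> 'a \<Rightarrow> real"
  defines "S \<equiv> (\<lambda>\<omega>. \<Sum>i\<in>I. X i \<omega>)"
  assumes "0 \<le> l" "0 \<le> \<delta>"
    and X: "\<And>i. i \<in> I \<Longrightarrow> bdd_rv M (X i)"
    and ab: "bdd_rv M a" "bdd_rv M b" "\<And>\<omega>. a \<omega> \<le> b \<omega>"
    and ab': "\<And>i. i \<in> I \<Longrightarrow> bdd_rv M (a' i)" "\<And>i. i \<in> I \<Longrightarrow> bdd_rv M (b' i)" "\<And>i \<omega>. a' i \<omega> \<le> b' i \<omega>"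
    and indep: "\<And>i. i \<in> I \<Longrightarrow>
      expectation (\<lambda>\<omega>. X i \<omega> * ramp \<delta> l (a' i \<omega>) (b' i \<omega>) (S \<omega> - X i \<omega>))
      = expectation (X i) * expectation (\<lambda>\<omega>. ramp \<delta> l (a' i \<omega>) (b' i \<omega>) (S \<omega> - X i \<omega>))"
  shows "expectation (\<lambda>\<omega>. exp (l * (S \<omega> - \<delta>)) * of_bool (a \<omega> \<le> S \<omega> \<and> S \<omega> \<le> b \<omega>)
        * (\<Sum>i\<in>I. \<bar>X i \<omega>\<bar> * min \<delta> \<bar>X i \<omega>\<bar>))
    \<le> (\<Sum>i\<in>I. expectation (\<lambda>\<omega>. \<bar>X i \<omega>\<bar> * exp (l * (S \<omega> - X i \<omega>)) * (\<bar>a \<omega> - a' i \<omega>\<bar> + \<bar>b \<omega> - b' i \<omega>\<bar>)))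
      + expectation (\<lambda>\<omega>. \<bar>S \<omega>\<bar> * exp (l * S \<omega>) * (b \<omega> - a \<omega> + 2 * \<delta>))
      + (\<Sum>i\<in>I. \<bar>expectation (X i)\<bar> * expectation (\<lambda>\<omega>. exp (l * (S \<omega> - X i \<omega>)) * (b' i \<omega> - a' i \<omega> + 2 * \<delta>)))"
    (is "expectation ?L \<le> (\<Sum>i\<in>I. expectation (?A i)) + expectation ?B + (\<Sum>i\<in>I. _ * expectation (?C i))")
proof -
  have S: "bdd_rv M S"
    unfolding S_def by (intro bdd_rv_sum X)
  let ?f = "\<lambda>\<omega>. ramp \<delta> l (a \<omega>) (b \<omega>)" and ?f' = "\<lambda>i \<omega>. ramp \<delta> l (a' i \<omega>) (b' i \<omega>)"
  let ?D = "\<lambda>i \<omega>. X i \<omega> * ?f' i \<omega> (S \<omega> - X i \<omega>)"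
  note bdd = bdd_rv_intros bdd_rv_ramp S X ab(1,2) ab'(1,2)
  have L: "integrable M ?L"
    by (intro integrable_bdd_rv bdd)
  have A: "integrable M (?A i)" if "i \<in> I" for i
    using that by (intro integrable_bdd_rv bdd)
  have B: "integrable M ?B"
    by (intro integrable_bdd_rv bdd)
  have C: "integrable M (?C i)" if "i \<in> I" for i
    using that by (intro integrable_bdd_rv bdd)
  have D: "integrable M (?D i)" if "i \<in> I" for i
    using that by (intro integrable_bdd_rv bdd)
  \<comment> \<open>The terms \<open>?D i\<close> stay exact here, because they are controlled only
    after taking expectations.\<close>
  have pointwise: "?L \<omega> \<le> (\<Sum>i\<in>I. ?A i \<omega>) + ?B \<omega> - (\<Sum>i\<in>I. ?D i \<omega>)" for \<omega>
  proof -
    have "?L \<omega> \<le> (\<Sum>i\<in>I. X i \<omega> * (?f \<omega> (S \<omega>) - ?f \<omega> (S \<omega> - X i \<omega>)))"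
      unfolding sum_distrib_left
      by (intro sum_mono ramp_increment_mult_ge \<open>0 \<le> l\<close> \<open>0 \<le> \<delta>\<close>)
    \<comment> \<open>The factors \<open>X i\<close> in front of the common value
      \<open>?f \<omega> (S \<omega>)\<close> add up to \<open>S\<close>; then \<open>?f' i\<close>
      is added and subtracted.\<close>
    also have "\<dots> = S \<omega> * ?f \<omega> (S \<omega>)
        + (\<Sum>i\<in>I. X i \<omega> * (?f' i \<omega> (S \<omega> - X i \<omega>) - ?f \<omega> (S \<omega> - X i \<omega>))) - (\<Sum>i\<in>I. ?D i \<omega>)"
      by (simp add: right_diff_distrib sum_subtractf sum_distrib_right[symmetric] S_def)
    also have "\<dots> \<le> ?B \<omega> + (\<Sum>i\<in>I. ?A i \<omega>) - (\<Sum>i\<in>I. ?D i \<omega>)"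
    proof (intro diff_right_mono add_mono sum_mono)
      have "S \<omega> * ?f \<omega> (S \<omega>) \<le> \<bar>S \<omega>\<bar> * ?f \<omega> (S \<omega>)"
        by (intro mult_right_mono) (auto simp: ramp_nonneg)
      also have "\<dots> \<le> \<bar>S \<omega>\<bar> * (exp (l * S \<omega>) * (b \<omega> - a \<omega> + 2 * \<delta>))"
        by (intro mult_left_mono ramp_le ab \<open>0 \<le> \<delta>\<close>) auto
      finally show "S \<omega> * ?f \<omega> (S \<omega>) \<le> ?B \<omega>"
        by (simp add: mult.assoc)
    next
      fix i
      have "X i \<omega> * (?f' i \<omega> (S \<omega> - X i \<omega>) - ?f \<omega> (S \<omega> - X i \<omega>))
          \<le> \<bar>X i \<omega>\<bar> * \<bar>?f \<omega> (S \<omega> - X i \<omega>) - ?f' i \<omega> (S \<omega> - X i \<omega>)\<bar>"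
        by (metis abs_ge_self abs_minus_commute abs_mult)
      also have "\<dots> \<le> \<bar>X i \<omega>\<bar> * (exp (l * (S \<omega> - X i \<omega>)) * (\<bar>a \<omega> - a' i \<omega>\<bar> + \<bar>b \<omega> - b' i \<omega>\<bar>))"
        by (intro mult_left_mono ramp_diff_le) auto
      finally show "X i \<omega> * (?f' i \<omega> (S \<omega> - X i \<omega>) - ?f \<omega> (S \<omega> - X i \<omega>)) \<le> ?A i \<omega>"
        by (simp add: mult.assoc)
    qed
    finally show ?thesis by simp
  qed
  have "expectation ?L \<le> expectation (\<lambda>\<omega>. (\<Sum>i\<in>I. ?A i \<omega>) + ?B \<omega> - (\<Sum>i\<in>I. ?D i \<omega>))"
    by (intro integral_mono pointwise L Bochner_Integration.integrable_add
        Bochner_Integration.integrable_diff Bochner_Integration.integrable_sum A B D)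
  also have "\<dots> = (\<Sum>i\<in>I. expectation (?A i)) + expectation ?B + (\<Sum>i\<in>I. - expectation (?D i))"
    using A B D
    by (simp add: Bochner_Integration.integral_sum Bochner_Integration.integrable_sum sum_negf
        Bochner_Integration.integral_add Bochner_Integration.integral_diff Bochner_Integration.integrable_add)
  also have "\<dots> \<le> (\<Sum>i\<in>I. expectation (?A i)) + expectation ?B + (\<Sum>i\<in>I. \<bar>expectation (X i)\<bar> * expectation (?C i))"
  proof (intro add_left_mono sum_mono)
    fix i assume i: "i \<in> I"
    \<comment> \<open>Truncated variables need not be centred, so the factor
      \<open>expectation (X i)\<close> survives.\<close>
    have "- expectation (?D i) = - expectation (X i) * expectation (\<lambda>\<omega>. ?f' i \<omega> (S \<omega> - X i \<omega>))"
      using indep[OF i] by simp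
    also have "\<dots> \<le> \<bar>expectation (X i)\<bar> * expectation (\<lambda>\<omega>. ?f' i \<omega> (S \<omega> - X i \<omega>))"
      by (intro mult_right_mono integral_nonneg) (auto simp: ramp_nonneg)
    also have "\<dots> \<le> \<bar>expectation (X i)\<bar> * expectation (?C i)"
    proof (intro mult_left_mono integral_mono)
      show "integrable M (\<lambda>\<omega>. ?f' i \<omega> (S \<omega> - X i \<omega>))"
        using i by (intro integrable_bdd_rv bdd)
    qed (use C i ramp_le ab'(3) \<open>0 \<le> \<delta>\<close> in auto)
    finally show "- expectation (?D i) \<le> \<bar>expectation (X i)\<bar> * expectation (?C i)" .
  qed
  finally show ?thesis .
qed

section \<open>Truncation and independence\<close>

lemma trunc1_eq: "trunc1 x = max (- 1) (min 1 x)"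
  by (auto simp: trunc1_def max_def min_def)

lemma abs_trunc1_le_1: "\<bar>trunc1 x\<bar> \<le> 1"
  by (auto simp: trunc1_eq)

lemma abs_trunc1_le_abs: "\<bar>trunc1 x\<bar> \<le> \<bar>x\<bar>"
  by (auto simp: trunc1_eq)

lemma measurable_trunc1 [measurable]: "trunc1 \<in> borel_measurable borel"
proof -
  have "trunc1 = (\<lambda>x. max (- 1) (min 1 x))"
    by (auto simp: trunc1_eq)
  moreover have "(\<lambda>x. max (- 1) (min 1 x)) \<in> borel_measurable (borel :: real measure)"
    by measurable
  ultimately show ?thesis by metis
qed

text \<open>Preimages under a composition are already preimages under the inner map, so the event
  families shrink and independence is inherited.\<close>

lemma indep_rv_compose:
  assumes "prob_space M" "indep_rv M N X K Y" "f \<in> measurable N N'" "g \<in> measurable K K'"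
  shows "indep_rv M N' (\<lambda>\<omega>. f (X \<omega>)) K' (\<lambda>\<omega>. g (Y \<omega>))"
proof -
  interpret prob_space M by fact
  have meas: "X \<in> measurable M N" "Y \<in> measurable M K"
    and ind: "indep_set {X -` A \<inter> space M | A. A \<in> sets N} {Y -` B \<inter> space M | B. B \<in> sets K}"
    using assms(2) by (auto simp: indep_rv_def)
  have vimage: "{(\<lambda>\<omega>. h (Z \<omega>)) -` A \<inter> space M | A. A \<in> sets L'} \<subseteq> {Z -` A \<inter> space M | A. A \<in> sets L}"
    if "Z \<in> measurable M L" "h \<in> measurable L L'" for h :: "'x \<Rightarrow> 'y" and Z :: "'a \<Rightarrow> 'x" and L L'
  proof safe
    fix A assume "A \<in> sets L'"
    then have "h -` A \<inter> space L \<in> sets L"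
      using that(2) by (rule measurable_sets[rotated])
    moreover have "(\<lambda>\<omega>. h (Z \<omega>)) -` A \<inter> space M = Z -` (h -` A \<inter> space L) \<inter> space M"
      using measurable_space[OF that(1)] by auto
    ultimately show "\<exists>B. (\<lambda>\<omega>. h (Z \<omega>)) -` A \<inter> space M = Z -` B \<inter> space M \<and> B \<in> sets L"
      by blast
  qed
  have "indep_set {(\<lambda>\<omega>. f (X \<omega>)) -` A \<inter> space M | A. A \<in> sets N'} {(\<lambda>\<omega>. g (Y \<omega>)) -` B \<inter> space M | B. B \<in> sets K'}"
    using ind vimage[OF meas(1) assms(3)] vimage[OF meas(2) assms(4)] unfolding indep_set_def
    by (elim indep_sets_mono_sets) (auto split: bool.split)
  then show ?thesis
    using meas assms(3,4) by (auto simp: indep_rv_def)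
qed

section \<open>Concentration for bounded endpoints\<close>

text \<open>The expectation is split along \<open>N\<close>, where \<open>U\<close> is at most half
  of \<open>c2\<close>. The tail bound applies to \<open>U\<close>, built from independent summands,
  and the ramp bound to the larger sum \<open>?V\<close>.\<close>

lemma (in prob_space) randomized_concentration_bdd:
  fixes I :: "'i set" and \<xi> :: "'i \<Rightarrow> 'a \<Rightarrow> real" and a b :: "'a \<Rightarrow> real" and a' b' :: "'i \<Rightarrow> 'a \<Rightarrow> real"
  defines "X \<equiv> \<lambda>i \<omega>. trunc1 (\<xi> i \<omega>)"
  defines "S \<equiv> (\<lambda>\<omega>. \<Sum>i\<in>I. X i \<omega>)"
  assumes "finite I" and indep_\<xi>: "indep_vars (\<lambda>_. borel) \<xi> I"
    and sq: "\<And>i. i \<in> I \<Longrightarrow> integrable M (\<lambda>\<omega>. (\<xi> i \<omega>)\<^sup>2)"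
    and c1: "0 < c1" "(\<Sum>i\<in>I. expectation (\<lambda>\<omega>. (\<xi> i \<omega>)\<^sup>2)) \<le> c1"
    and c2: "0 < c2" "c2 \<le> (\<Sum>i\<in>I. expectation (\<lambda>\<omega>. \<bar>X i \<omega>\<bar> * min \<delta> (\<bar>\<xi> i \<omega>\<bar> / 2)))"
    and \<delta>: "0 < \<delta>" "\<delta> < 1 / 2" and "0 \<le> l"
    and ab: "bdd_rv M a" "bdd_rv M b" "\<And>\<omega>. a \<omega> \<le> b \<omega>"
    and ab': "\<And>i. i \<in> I \<Longrightarrow> bdd_rv M (a' i)" "\<And>i. i \<in> I \<Longrightarrow> bdd_rv M (b' i)" "\<And>i \<omega>. a' i \<omega> \<le> b' i \<omega>"
    and indep: "\<And>i. i \<in> I \<Longrightarrow>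
      expectation (\<lambda>\<omega>. X i \<omega> * ramp \<delta> l (a' i \<omega>) (b' i \<omega>) (S \<omega> - X i \<omega>))
      = expectation (X i) * expectation (\<lambda>\<omega>. ramp \<delta> l (a' i \<omega>) (b' i \<omega>) (S \<omega> - X i \<omega>))"
  shows "expectation (\<lambda>\<omega>. exp (l * S \<omega>) * of_bool (a \<omega> \<le> S \<omega> \<and> S \<omega> \<le> b \<omega>))
    \<le> sqrt (expectation (\<lambda>\<omega>. exp (2 * l * S \<omega>))) * exp (- (c2\<^sup>2 / (16 * c1 * \<delta>\<^sup>2)))
      + 2 * exp (l * \<delta>) / c2 *
        ((\<Sum>i\<in>I. expectation (\<lambda>\<omega>. \<bar>X i \<omega>\<bar> * exp (l * (S \<omega> - X i \<omega>)) * (\<bar>a \<omega> - a' i \<omega>\<bar> + \<bar>b \<omega> - b' i \<omega>\<bar>)))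
        + expectation (\<lambda>\<omega>. \<bar>S \<omega>\<bar> * exp (l * S \<omega>) * (b \<omega> - a \<omega> + 2 * \<delta>))
        + (\<Sum>i\<in>I. \<bar>expectation (X i)\<bar> * expectation (\<lambda>\<omega>. exp (l * (S \<omega> - X i \<omega>)) * (b' i \<omega> - a' i \<omega> + 2 * \<delta>))))"
    (is "expectation ?L \<le> _ * ?q + ?k * ?R")
proof -
  define \<eta> where "\<eta> i \<omega> = \<bar>X i \<omega>\<bar> * min \<delta> (\<bar>\<xi> i \<omega>\<bar> / 2)" for i \<omega>
  define U where "U \<omega> = (\<Sum>i\<in>I. \<eta> i \<omega>)" for \<omega>
  define N where "N = {\<omega> \<in> space M. U \<omega> \<le> c2 / 2}"
  define J where "J \<omega> = (of_bool (a \<omega> \<le> S \<omega> \<and> S \<omega> \<le> b \<omega>) :: real)" for \<omega>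
  let ?V = "\<lambda>\<omega>. \<Sum>i\<in>I. \<bar>X i \<omega>\<bar> * min \<delta> \<bar>X i \<omega>\<bar>"
  let ?T = "\<lambda>\<omega>. exp (l * (S \<omega> - \<delta>)) * J \<omega> * ?V \<omega>"
  have meas [measurable]: "\<xi> i \<in> borel_measurable M" if "i \<in> I" for i
    using indep_\<xi> that by (auto simp: indep_vars_def)
  have X: "bdd_rv M (X i)" if "i \<in> I" for i
    using that unfolding X_def by (intro bdd_rvI[of _ _ 1] abs_trunc1_le_1) measurable
  have S: "bdd_rv M S"
    unfolding S_def by (intro bdd_rv_sum X)
  note bdd = bdd_rv_intros S X ab(1,2)
  have [measurable]: "\<eta> i \<in> borel_measurable M" if "i \<in> I" for i
    using that unfolding \<eta>_def X_def by measurable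
  have [measurable]: "U \<in> borel_measurable M"
    unfolding U_def by measurable
  have [measurable]: "N \<in> events"
    unfolding N_def by measurable
  have \<eta>_nonneg: "0 \<le> \<eta> i \<omega>" for i \<omega>
    using \<delta> by (simp add: \<eta>_def)
  \<comment> \<open>From \<open>\<bar>X i \<omega>\<bar> \<le> \<bar>\<xi> i \<omega>\<bar>\<close>
    and the cap \<delta>; summed, it gives the second-moment bound
    \<open>\<delta>\<^sup>2 * c1\<close>.\<close>
  have \<eta>_sq: "(\<eta> i \<omega>)\<^sup>2 \<le> \<delta>\<^sup>2 * (\<xi> i \<omega>)\<^sup>2" for i \<omega>
  proof -
    have "\<eta> i \<omega> \<le> \<bar>\<xi> i \<omega>\<bar> * \<delta>"
      unfolding \<eta>_def X_def using \<delta> by (intro mult_mono abs_trunc1_le_abs) auto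
    then have "(\<eta> i \<omega>)\<^sup>2 \<le> (\<bar>\<xi> i \<omega>\<bar> * \<delta>)\<^sup>2"
      using \<eta>_nonneg by (rule power_mono)
    then show ?thesis by (simp add: power_mult_distrib mult.commute)
  qed
  \<comment> \<open>Where the truncation is active, \<open>\<bar>X i \<omega>\<bar> = 1\<close>
    exceeds \<delta>; elsewhere it equals \<open>\<bar>\<xi> i \<omega>\<bar>\<close>.\<close>
  have \<eta>_le: "\<eta> i \<omega> \<le> \<bar>X i \<omega>\<bar> * min \<delta> \<bar>X i \<omega>\<bar>" for i \<omega>
    unfolding \<eta>_def using \<delta> by (intro mult_left_mono) (auto simp: X_def trunc1_eq)
  have int_\<eta>_sq: "integrable M (\<lambda>\<omega>. (\<eta> i \<omega>)\<^sup>2)" if "i \<in> I" for i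
  proof (rule Bochner_Integration.integrable_bound)
    show "integrable M (\<lambda>\<omega>. \<delta>\<^sup>2 * (\<xi> i \<omega>)\<^sup>2)"
      using sq[OF that] by (rule integrable_mult_right)
    show "(\<lambda>\<omega>. (\<eta> i \<omega>)\<^sup>2) \<in> borel_measurable M"
      using that by measurable
    show "AE \<omega> in M. norm ((\<eta> i \<omega>)\<^sup>2) \<le> norm (\<delta>\<^sup>2 * (\<xi> i \<omega>)\<^sup>2)"
      using \<eta>_sq by (intro AE_I2) (simp add: abs_mult)
  qed
  \<comment> \<open>The mean of \<open>U\<close> is at least \<open>c2\<close>, so on
    \<open>N\<close> the sum falls short of its mean by at least \<open>c2 / 2\<close>.\<close>
  have "prob N \<le> prob {\<omega> \<in> space M. U \<omega> \<le> (\<Sum>i\<in>I. expectation (\<eta> i)) - c2 / 2}"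
    using c2 unfolding N_def \<eta>_def by (intro finite_measure_mono) (auto simp: \<eta>_def[symmetric])
  also have "\<dots> \<le> exp (- ((c2 / 2)\<^sup>2 / (2 * (\<delta>\<^sup>2 * c1))))"
    unfolding U_def
  proof (rule lower_tail_sum_nonneg_indep[OF \<open>finite I\<close> _ \<eta>_nonneg int_\<eta>_sq])
    have "indep_vars (\<lambda>_. borel) (\<lambda>i \<omega>. (\<lambda>x. \<bar>trunc1 x\<bar> * min \<delta> (\<bar>x\<bar> / 2)) (\<xi> i \<omega>)) I"
      by (rule indep_vars_compose2[OF indep_\<xi>]) measurable
    then show "indep_vars (\<lambda>_. borel) \<eta> I"
      by (simp add: \<eta>_def[abs_def] X_def)
    have "(\<Sum>i\<in>I. expectation (\<lambda>\<omega>. (\<eta> i \<omega>)\<^sup>2)) \<le> (\<Sum>i\<in>I. expectation (\<lambda>\<omega>. \<delta>\<^sup>2 * (\<xi> i \<omega>)\<^sup>2))"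
      using int_\<eta>_sq sq \<eta>_sq by (intro sum_mono integral_mono) auto
    also have "\<dots> = \<delta>\<^sup>2 * (\<Sum>i\<in>I. expectation (\<lambda>\<omega>. (\<xi> i \<omega>)\<^sup>2))"
      by (simp add: sum_distrib_left)
    also have "\<dots> \<le> \<delta>\<^sup>2 * c1"
      using c1 by (intro mult_left_mono) auto
    finally show "(\<Sum>i\<in>I. expectation (\<lambda>\<omega>. (\<eta> i \<omega>)\<^sup>2)) \<le> \<delta>\<^sup>2 * c1" .
  qed (use \<delta> c1 c2 in auto)
  \<comment> \<open>The tail exponent is \<open>c2\<^sup>2 / (8 * c1 * \<delta>\<^sup>2)\<close>;
    the root in Cauchy--Schwarz turns 8 into 16.\<close>
  also have "\<dots> = ?q\<^sup>2"
    using \<delta> c1 by (simp add: exp_double[symmetric] power_divide field_simps)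
  finally have prob_N: "prob N \<le> ?q\<^sup>2" .
  have "expectation (\<lambda>\<omega>. exp (l * S \<omega>) * indicator N \<omega>) \<le> sqrt (expectation (\<lambda>\<omega>. (exp (l * S \<omega>))\<^sup>2)) * ?q"
  proof (rule expectation_indicator_le_Cauchy_Schwarz[OF _ _ _ prob_N])
    show "(\<lambda>\<omega>. exp (l * S \<omega>)) \<in> borel_measurable M"
      by (intro bdd)
    show "integrable M (\<lambda>\<omega>. (exp (l * S \<omega>))\<^sup>2)"
      unfolding power2_eq_square by (intro integrable_bdd_rv bdd)
  qed auto
  then have CS: "expectation (\<lambda>\<omega>. exp (l * S \<omega>) * indicator N \<omega>) \<le> sqrt (expectation (\<lambda>\<omega>. exp (2 * l * S \<omega>))) * ?q"
    by (simp add: exp_double[symmetric] mult.assoc)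
  have ramp: "expectation ?T \<le> ?R"
    unfolding J_def S_def using X ab ab' indep \<delta> \<open>0 \<le> l\<close> by (intro ramp_test_bound) (auto simp: S_def)
  have intT: "integrable M ?T"
    unfolding J_def by (intro integrable_bdd_rv bdd)
  have intN: "integrable M (\<lambda>\<omega>. exp (l * S \<omega>) * indicator N \<omega>)"
    by (intro integrable_real_mult_indicator integrable_bdd_rv bdd) measurable
  have "expectation ?L \<le> expectation (\<lambda>\<omega>. exp (l * S \<omega>) * indicator N \<omega> + ?k * ?T \<omega>)"
  proof (rule integral_mono)
    show "integrable M ?L"
      by (intro integrable_bdd_rv bdd)
    show "integrable M (\<lambda>\<omega>. exp (l * S \<omega>) * indicator N \<omega> + ?k * ?T \<omega>)"
      by (intro Bochner_Integration.integrable_add integrable_mult_right intT intN)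
    fix \<omega> assume \<omega>: "\<omega> \<in> space M"
    \<comment> \<open>The factor \<open>exp (l * \<delta>)\<close> in \<open>?k\<close> cancels the
      loss in the ramp bound.\<close>
    have kT: "?k * ?T \<omega> = exp (l * S \<omega>) * J \<omega> * (2 / c2 * ?V \<omega>)"
      by (simp add: right_diff_distrib exp_diff)
    have V0: "0 \<le> ?V \<omega>"
      using \<delta> by (intro sum_nonneg) auto
    have J: "0 \<le> J \<omega>" "J \<omega> \<le> 1"
      by (auto simp: J_def)
    show "?L \<omega> \<le> exp (l * S \<omega>) * indicator N \<omega> + ?k * ?T \<omega>"
    proof (cases "\<omega> \<in> N")
      case True
      then show ?thesis
        using J V0 c2 unfolding kT J_def[symmetric] by (intro add_increasing2) auto
    next
      case False
      \<comment> \<open>Off \<open>N\<close> the factor \<open>2 / c2 * ?V \<omega>\<close> is at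
        least 1 and can be inserted for free.\<close>
      then have "c2 / 2 \<le> U \<omega>"
        using \<omega> by (auto simp: N_def)
      also have "\<dots> \<le> ?V \<omega>"
        unfolding U_def by (intro sum_mono \<eta>_le)
      finally have "1 \<le> 2 / c2 * ?V \<omega>"
        using c2 by (simp add: field_simps)
      then have "exp (l * S \<omega>) * J \<omega> * 1 \<le> exp (l * S \<omega>) * J \<omega> * (2 / c2 * ?V \<omega>)"
        using J by (intro mult_left_mono) auto
      then show ?thesis
        using False unfolding kT J_def[symmetric] by simp
    qed
  qed
  also have "\<dots> = expectation (\<lambda>\<omega>. exp (l * S \<omega>) * indicator N \<omega>) + ?k * expectation ?T"
    using intN intT by simp
  also have "\<dots> \<le> sqrt (expectation (\<lambda>\<omega>. exp (2 * l * S \<omega>))) * ?q + ?k * ?R"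
    using c2 by (intro add_mono CS mult_left_mono ramp) auto
  finally show ?thesis .
qed

section \<open>Sorting and clamping arbitrary endpoints\<close>

definition clamp_min :: "real \<Rightarrow> real \<Rightarrow> real \<Rightarrow> real" where
  "clamp_min T x y = max (- T) (min T (min x y))"

definition clamp_max :: "real \<Rightarrow> real \<Rightarrow> real \<Rightarrow> real" where
  "clamp_max T x y = max (- T) (min T (max x y))"

lemma clamp_min_le_clamp_max: "clamp_min T x y \<le> clamp_max T x y"
  unfolding clamp_min_def clamp_max_def by (intro max.mono min.mono) auto

lemma clamp_max_diff_clamp_min_le: "clamp_max T x y - clamp_min T x y \<le> \<bar>y - x\<bar>"
  by (auto simp: clamp_min_def clamp_max_def max_def min_def)

text \<open>Sorting a pair does not increase the sum of coordinate distances, and clamping is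
  1-Lipschitz in each coordinate.\<close>

lemma clamp_min_max_contraction:
  "\<bar>clamp_min T x y - clamp_min T x' y'\<bar> + \<bar>clamp_max T x y - clamp_max T x' y'\<bar> \<le> \<bar>x - x'\<bar> + \<bar>y - y'\<bar>"
proof -
  have clamp: "\<bar>max (- T) (min T u) - max (- T) (min T v)\<bar> \<le> \<bar>u - v\<bar>" for u v :: real
    by (auto simp: max_def min_def)
  have "\<bar>min x y - min x' y'\<bar> + \<bar>max x y - max x' y'\<bar> \<le> \<bar>x - x'\<bar> + \<bar>y - y'\<bar>"
    by (auto simp: max_def min_def)
  then show ?thesis
    using clamp[of "min x y" "min x' y'"] clamp[of "max x y" "max x' y'"]
    unfolding clamp_min_def clamp_max_def by linarith
qed

text \<open>Under these inequalities the pair is already sorted, and clamping to an interval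
  containing \<open>s\<close> leaves \<open>s\<close> between the endpoints.\<close>

lemma clamp_min_max_between:
  "\<bar>s\<bar> \<le> T \<Longrightarrow> x \<le> s \<Longrightarrow> s \<le> y \<Longrightarrow> clamp_min T x y \<le> s \<and> s \<le> clamp_max T x y"
  by (auto simp: clamp_min_def clamp_max_def max_def min_def)

lemma bdd_rv_clamp:
  assumes [measurable]: "f \<in> borel_measurable M" "g \<in> borel_measurable M" and "0 \<le> T"
  shows "bdd_rv M (\<lambda>\<omega>. clamp_min T (f \<omega>) (g \<omega>))" "bdd_rv M (\<lambda>\<omega>. clamp_max T (f \<omega>) (g \<omega>))"
proof -
  show "bdd_rv M (\<lambda>\<omega>. clamp_min T (f \<omega>) (g \<omega>))"
    unfolding clamp_min_def
  proof (rule bdd_rvI[of _ _ T])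
    show "\<bar>max (- T) (min T (min (f \<omega>) (g \<omega>)))\<bar> \<le> T" for \<omega>
      using \<open>0 \<le> T\<close> by linarith
  qed measurable
  show "bdd_rv M (\<lambda>\<omega>. clamp_max T (f \<omega>) (g \<omega>))"
    unfolding clamp_max_def
  proof (rule bdd_rvI[of _ _ T])
    show "\<bar>max (- T) (min T (max (f \<omega>) (g \<omega>)))\<bar> \<le> T" for \<omega>
      using \<open>0 \<le> T\<close> by linarith
  qed measurable
qed

lemma nn_expectation_mono:
  "(\<And>\<omega>. f \<omega> \<le> g \<omega>) \<Longrightarrow> nn_expectation M f \<le> nn_expectation M g"
  unfolding nn_expectation_def by (intro nn_integral_mono ennreal_leI)

lemma (in prob_space) nn_expectation_eq:
  "bdd_rv M f \<Longrightarrow> (\<And>\<omega>. 0 \<le> f \<omega>) \<Longrightarrow> nn_expectation M f = ennreal (expectation f)"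
  unfolding nn_expectation_def by (intro nn_integral_eq_integral integrable_bdd_rv) auto

text \<open>The bounded case is proved in the reals for clamped endpoints and carried to
  \<open>ennreal\<close>. Only the last comparison returns to the original endpoints, whose terms
  may be infinite.\<close>

lemma (in prob_space) randomized_concentration:
  fixes I :: "'i set" and \<xi> :: "'i \<Rightarrow> 'a \<Rightarrow> real" and \<Delta>1 \<Delta>2 :: "'a \<Rightarrow> real" and \<Delta>1' \<Delta>2' W' :: "'i \<Rightarrow> 'a \<Rightarrow> real"
  defines "X \<equiv> \<lambda>i \<omega>. trunc1 (\<xi> i \<omega>)"
  defines "S \<equiv> (\<lambda>\<omega>. \<Sum>i\<in>I. X i \<omega>)"
  assumes "finite I" and indep_\<xi>: "indep_vars (\<lambda>_. borel) \<xi> I"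
    and sq: "\<And>i. i \<in> I \<Longrightarrow> integrable M (\<lambda>\<omega>. (\<xi> i \<omega>)\<^sup>2)"
    and c1: "0 < c1" "(\<Sum>i\<in>I. expectation (\<lambda>\<omega>. (\<xi> i \<omega>)\<^sup>2)) \<le> c1"
    and c2: "0 < c2" "c2 \<le> (\<Sum>i\<in>I. expectation (\<lambda>\<omega>. \<bar>X i \<omega>\<bar> * min \<delta> (\<bar>\<xi> i \<omega>\<bar> / 2)))"
    and \<delta>: "0 < \<delta>" "\<delta> < 1 / 2" and "0 \<le> l"
    and \<Delta>: "\<Delta>1 \<in> borel_measurable M" "\<Delta>2 \<in> borel_measurable M"
    and \<Delta>': "\<And>i. i \<in> I \<Longrightarrow> \<Delta>1' i \<in> borel_measurable M" "\<And>i. i \<in> I \<Longrightarrow> \<Delta>2' i \<in> borel_measurable M"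
    and indep: "\<And>i. i \<in> I \<Longrightarrow> indep_rv M borel (\<xi> i) borel (\<lambda>\<omega>. (\<Delta>1' i \<omega>, \<Delta>2' i \<omega>, W' i \<omega>, S \<omega> - X i \<omega>))"
  shows "nn_expectation M (\<lambda>\<omega>. exp (l * S \<omega>) * of_bool (\<Delta>1 \<omega> \<le> S \<omega> \<and> S \<omega> \<le> \<Delta>2 \<omega>))
    \<le> ennreal (sqrt (expectation (\<lambda>\<omega>. exp (2 * l * S \<omega>))) * exp (- (c2\<^sup>2 / (16 * c1 * \<delta>\<^sup>2))))
      + ennreal (2 * exp (l * \<delta>) / c2) *
        ((\<Sum>i\<in>I. nn_expectation M (\<lambda>\<omega>. \<bar>X i \<omega>\<bar> * exp (l * (S \<omega> - X i \<omega>)) *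
            (\<bar>\<Delta>1 \<omega> - \<Delta>1' i \<omega>\<bar> + \<bar>\<Delta>2 \<omega> - \<Delta>2' i \<omega>\<bar>)))
        + nn_expectation M (\<lambda>\<omega>. \<bar>S \<omega>\<bar> * exp (l * S \<omega>) * (\<bar>\<Delta>2 \<omega> - \<Delta>1 \<omega>\<bar> + 2 * \<delta>))
        + (\<Sum>i\<in>I. ennreal \<bar>expectation (X i)\<bar> *
            nn_expectation M (\<lambda>\<omega>. exp (l * (S \<omega> - X i \<omega>)) * (\<bar>\<Delta>2' i \<omega> - \<Delta>1' i \<omega>\<bar> + 2 * \<delta>))))"
    (is "?L \<le> ennreal ?Q + ennreal ?k * ((\<Sum>i\<in>I. ?A i) + ?B + (\<Sum>i\<in>I. _ * ?C i))")
proof -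
  \<comment> \<open>Each truncated variable is at most 1 in absolute value, so this level bounds
    \<open>S\<close>.\<close>
  define T where "T = real (card I)"
  define a where "a \<omega> = clamp_min T (\<Delta>1 \<omega>) (\<Delta>2 \<omega>)" for \<omega>
  define b where "b \<omega> = clamp_max T (\<Delta>1 \<omega>) (\<Delta>2 \<omega>)" for \<omega>
  define a' where "a' i \<omega> = clamp_min T (\<Delta>1' i \<omega>) (\<Delta>2' i \<omega>)" for i \<omega>
  define b' where "b' i \<omega> = clamp_max T (\<Delta>1' i \<omega>) (\<Delta>2' i \<omega>)" for i \<omega>
  have meas [measurable]: "\<xi> i \<in> borel_measurable M" if "i \<in> I" for i
    using indep_\<xi> that by (auto simp: indep_vars_def)
  have X: "bdd_rv M (X i)" if "i \<in> I" for i
    using that unfolding X_def by (intro bdd_rvI[of _ _ 1] abs_trunc1_le_1) measurable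
  have S: "bdd_rv M S"
    unfolding S_def by (intro bdd_rv_sum X)
  have S_le: "\<bar>S \<omega>\<bar> \<le> T" for \<omega>
  proof -
    have "\<bar>S \<omega>\<bar> \<le> (\<Sum>i\<in>I. 1)"
      unfolding S_def X_def by (intro sum_abs[THEN order_trans] sum_mono abs_trunc1_le_1)
    then show ?thesis by (simp add: T_def)
  qed
  have ab: "bdd_rv M a" "bdd_rv M b" "\<And>\<omega>. a \<omega> \<le> b \<omega>"
    unfolding a_def b_def using \<Delta> by (auto intro!: bdd_rv_clamp clamp_min_le_clamp_max simp: T_def)
  have ab': "bdd_rv M (a' i)" "bdd_rv M (b' i)" if "i \<in> I" for i
    unfolding a'_def b'_def using that \<Delta>' by (auto intro!: bdd_rv_clamp simp: T_def)
  have ab'_le: "a' i \<omega> \<le> b' i \<omega>" for i \<omega>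
    unfolding a'_def b'_def by (rule clamp_min_le_clamp_max)
  note bdd = bdd_rv_intros S X ab(1,2) ab'
  let ?A' = "\<lambda>i \<omega>. \<bar>X i \<omega>\<bar> * exp (l * (S \<omega> - X i \<omega>)) * (\<bar>a \<omega> - a' i \<omega>\<bar> + \<bar>b \<omega> - b' i \<omega>\<bar>)"
  let ?B' = "\<lambda>\<omega>. \<bar>S \<omega>\<bar> * exp (l * S \<omega>) * (b \<omega> - a \<omega> + 2 * \<delta>)"
  let ?C' = "\<lambda>i \<omega>. exp (l * (S \<omega> - X i \<omega>)) * (b' i \<omega> - a' i \<omega> + 2 * \<delta>)"
  have pos: "0 \<le> ?A' i \<omega>" "0 \<le> ?B' \<omega>" "0 \<le> ?C' i \<omega>" for i \<omega>
    using ab(3)[of \<omega>] ab'_le[of i \<omega>] \<delta> by auto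
  have pos': "0 \<le> expectation (?A' i)" "0 \<le> expectation ?B'" "0 \<le> expectation (?C' i)" for i
    using pos by (auto intro: integral_nonneg)
  have factor: "expectation (\<lambda>\<omega>. X i \<omega> * ramp \<delta> l (a' i \<omega>) (b' i \<omega>) (S \<omega> - X i \<omega>))
      = expectation (X i) * expectation (\<lambda>\<omega>. ramp \<delta> l (a' i \<omega>) (b' i \<omega>) (S \<omega> - X i \<omega>))" if i: "i \<in> I" for i
  proof -
    \<comment> \<open>The clamped test function is a continuous, hence Borel, function of the
      quadruple in \<open>indep\<close>, so it inherits independence from
      \<open>X i\<close>.\<close>
    let ?g = "\<lambda>(x, y, _, w). ramp \<delta> l (clamp_min T x y) (clamp_max T x y) w"
    have "?g \<in> borel_measurable (borel :: (real \<times> real \<times> real \<times> real) measure)"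
      unfolding ramp_def clamp_min_def clamp_max_def split_beta
      by (intro borel_measurable_continuous_onI continuous_intros)
    from indep_rv_compose[OF prob_space_axioms indep[OF i] measurable_trunc1 this]
    have "indep_var borel (X i) borel (\<lambda>\<omega>. ramp \<delta> l (a' i \<omega>) (b' i \<omega>) (S \<omega> - X i \<omega>))"
      by (simp add: indep_rv_iff_indep_var[OF prob_space_axioms] X_def a'_def b'_def)
    then show ?thesis
      using i by (intro indep_var_lebesgue_integral integrable_bdd_rv bdd_rv_ramp bdd)
  qed
  have "?L \<le> nn_expectation M (\<lambda>\<omega>. exp (l * S \<omega>) * of_bool (a \<omega> \<le> S \<omega> \<and> S \<omega> \<le> b \<omega>))"
    using clamp_min_max_between[OF S_le] unfolding a_def b_def by (intro nn_expectation_mono) auto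
  also have "\<dots> = ennreal (expectation (\<lambda>\<omega>. exp (l * S \<omega>) * of_bool (a \<omega> \<le> S \<omega> \<and> S \<omega> \<le> b \<omega>)))"
    by (intro nn_expectation_eq bdd) auto
  also have "\<dots> \<le> ennreal (?Q + ?k * ((\<Sum>i\<in>I. expectation (?A' i)) + expectation ?B'
      + (\<Sum>i\<in>I. \<bar>expectation (X i)\<bar> * expectation (?C' i))))"
    using factor ab ab' ab'_le c1 c2 \<delta> \<open>0 \<le> l\<close> \<open>finite I\<close> indep_\<xi> sq unfolding S_def X_def
    by (intro ennreal_leI randomized_concentration_bdd) auto
  \<comment> \<open>Nonnegativity of every part lets \<open>ennreal\<close> pass through sums and
    products.\<close>
  also have "\<dots> = ennreal ?Q + ennreal ?k * ((\<Sum>i\<in>I. ennreal (expectation (?A' i))) + ennreal (expectation ?B')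
      + (\<Sum>i\<in>I. ennreal \<bar>expectation (X i)\<bar> * ennreal (expectation (?C' i))))"
    using pos' c2
    by (simp add: ennreal_plus[symmetric] ennreal_mult[symmetric] sum_ennreal sum_nonneg del: ennreal_plus)
  also have "\<dots> = ennreal ?Q + ennreal ?k * ((\<Sum>i\<in>I. nn_expectation M (?A' i)) + nn_expectation M ?B'
      + (\<Sum>i\<in>I. ennreal \<bar>expectation (X i)\<bar> * nn_expectation M (?C' i)))"
  proof -
    have "nn_expectation M (?A' i) = ennreal (expectation (?A' i))"
      "nn_expectation M (?C' i) = ennreal (expectation (?C' i))" if "i \<in> I" for i
      using that by (auto intro!: nn_expectation_eq bdd pos)
    moreover have "nn_expectation M ?B' = ennreal (expectation ?B')"
      by (intro nn_expectation_eq bdd pos)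
    ultimately show ?thesis by simp
  qed
  also have "\<dots> \<le> ennreal ?Q + ennreal ?k * ((\<Sum>i\<in>I. ?A i) + ?B + (\<Sum>i\<in>I. ennreal \<bar>expectation (X i)\<bar> * ?C i))"
  proof (intro add_left_mono mult_left_mono add_mono sum_mono)
    fix i
    show "nn_expectation M (?A' i) \<le> ?A i"
      unfolding a_def b_def a'_def b'_def
      by (intro nn_expectation_mono mult_left_mono clamp_min_max_contraction) auto
    show "nn_expectation M (?C' i) \<le> ?C i"
      unfolding a'_def b'_def
      by (intro nn_expectation_mono mult_left_mono add_right_mono clamp_max_diff_clamp_min_le) auto
    show "nn_expectation M ?B' \<le> ?B"
      unfolding a_def b_def
      by (intro nn_expectation_mono mult_left_mono add_right_mono clamp_max_diff_clamp_min_le) auto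
  qed auto
  finally show ?thesis .
qed

section \<open>The explicit choice of parameters\<close>

text \<open>For \<open>\<bar>x\<bar> \<le> 1\<close>, the square of
  \<open>\<bar>x\<bar> / 4 - \<delta>\<close> being nonnegative gives \<open>\<bar>x\<bar> / 2 -
  x\<^sup>2 / (16 * \<delta>) \<le> \<delta>\<close>; multiply by \<open>\<bar>x\<bar>\<close>.
  Otherwise the left side is 0.\<close>

lemma abs_trunc1_mult_min_ge:
  assumes "0 < \<delta>"
  shows "(x\<^sup>2 - x\<^sup>2 * of_bool (\<bar>x\<bar> > 1)) / 2 - \<bar>x\<bar> ^ 3 * of_bool (\<bar>x\<bar> \<le> 1) / (16 * \<delta>)
    \<le> \<bar>trunc1 x\<bar> * min \<delta> (\<bar>x\<bar> / 2)"
proof (cases "\<bar>x\<bar> \<le> 1")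
  case True
  have "0 \<le> (\<bar>x\<bar> / 4 - \<delta>)\<^sup>2 / \<delta>"
    using assms by simp
  then have "\<bar>x\<bar> / 2 - x\<^sup>2 / (16 * \<delta>) \<le> min \<delta> (\<bar>x\<bar> / 2)"
    using assms by (auto simp: field_simps power2_eq_square)
  then have "\<bar>x\<bar> * (\<bar>x\<bar> / 2 - x\<^sup>2 / (16 * \<delta>)) \<le> \<bar>x\<bar> * min \<delta> (\<bar>x\<bar> / 2)"
    by (rule mult_left_mono) simp
  moreover have "\<bar>x\<bar> * (\<bar>x\<bar> / 2 - x\<^sup>2 / (16 * \<delta>)) = x\<^sup>2 / 2 - \<bar>x\<bar> ^ 3 / (16 * \<delta>)"
    by (simp add: right_diff_distrib power3_eq_cube power2_eq_square)
  moreover have "trunc1 x = x"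
    using True by (auto simp: trunc1_eq)
  ultimately show ?thesis
    using True by simp
next
  case False
  then show ?thesis
    using assms by simp
qed

text \<open>Values up to \<open>t\<close> are paid for by \<open>t\<^sup>2\<close>, and those
  between \<open>t\<close> and 1 by the cubic term. With free \<open>t\<close>, this shows that
  vanishing truncated moments force vanishing second moments.\<close>

lemma square_le_truncated_moments:
  fixes x t :: real
  assumes "0 < t"
  shows "x\<^sup>2 \<le> x\<^sup>2 * of_bool (\<bar>x\<bar> > 1) + \<bar>x\<bar> ^ 3 * of_bool (\<bar>x\<bar> \<le> 1) / t + t\<^sup>2"
proof (cases "\<bar>x\<bar> \<le> 1")
  case True
  have "x\<^sup>2 \<le> \<bar>x\<bar> ^ 3 / t + t\<^sup>2"
  proof (cases "\<bar>x\<bar> \<le> t")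
    case True
    then have "\<bar>x\<bar>\<^sup>2 \<le> t\<^sup>2"
      by (intro power_mono) auto
    moreover have "0 \<le> \<bar>x\<bar> ^ 3 / t"
      using assms by simp
    ultimately show ?thesis by simp
  next
    case False
    then have "x\<^sup>2 * t \<le> x\<^sup>2 * \<bar>x\<bar>"
      by (intro mult_left_mono) auto
    then have "x\<^sup>2 \<le> \<bar>x\<bar> ^ 3 / t"
      using assms by (simp add: field_simps power3_eq_cube power2_eq_square)
    then show ?thesis by (simp add: add_increasing2)
  qed
  then show ?thesis using True by simp
qed simp

lemma (in prob_space) truncated_moments_choice:
  fixes I :: "'i set" and \<xi> :: "'i \<Rightarrow> 'a \<Rightarrow> real"
  defines "\<beta>2 \<equiv> \<Sum>i\<in>I. expectation (\<lambda>\<omega>. (\<xi> i \<omega>)\<^sup>2 * of_bool (\<bar>\<xi> i \<omega>\<bar> > 1))"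
    and "\<beta>3 \<equiv> \<Sum>i\<in>I. expectation (\<lambda>\<omega>. \<bar>\<xi> i \<omega>\<bar> ^ 3 * of_bool (\<bar>\<xi> i \<omega>\<bar> \<le> 1))"
  assumes meas: "\<And>i. i \<in> I \<Longrightarrow> \<xi> i \<in> borel_measurable M"
    and sq: "\<And>i. i \<in> I \<Longrightarrow> integrable M (\<lambda>\<omega>. (\<xi> i \<omega>)\<^sup>2)"
    and one: "(\<Sum>i\<in>I. expectation (\<lambda>\<omega>. (\<xi> i \<omega>)\<^sup>2)) = 1"
    and le: "\<beta>2 + \<beta>3 \<le> 1 / 2"
  shows "0 < \<beta>2 + \<beta>3"
    and "1 / 4 \<le> (\<Sum>i\<in>I. expectation (\<lambda>\<omega>. \<bar>trunc1 (\<xi> i \<omega>)\<bar> * min ((\<beta>2 + \<beta>3) / 4) (\<bar>\<xi> i \<omega>\<bar> / 2)))"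
proof -
  note [measurable] = meas
  let ?P = "\<lambda>i \<omega>. (\<xi> i \<omega>)\<^sup>2 * of_bool (\<bar>\<xi> i \<omega>\<bar> > 1)" and ?Q = "\<lambda>i \<omega>. \<bar>\<xi> i \<omega>\<bar> ^ 3 * of_bool (\<bar>\<xi> i \<omega>\<bar> \<le> 1)"
  have intP: "integrable M (?P i)" if "i \<in> I" for i
  proof (rule Bochner_Integration.integrable_bound[OF sq[OF that]])
    show "?P i \<in> borel_measurable M"
      using that by measurable
  qed auto
  have intQ: "integrable M (?Q i)" if "i \<in> I" for i
  proof (rule integrable_const_bound[of _ 1])
    show "?Q i \<in> borel_measurable M"
      using that by measurable
  qed (auto simp: power_le_one)
  have \<beta>_nonneg: "0 \<le> \<beta>2" "0 \<le> \<beta>3"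
    unfolding \<beta>2_def \<beta>3_def by (auto intro!: sum_nonneg integral_nonneg)
  show pos: "0 < \<beta>2 + \<beta>3"
  proof (rule ccontr)
    assume "\<not> 0 < \<beta>2 + \<beta>3"
    then have zero: "\<beta>2 = 0" "\<beta>3 = 0"
      using \<beta>_nonneg by auto
    \<comment> \<open>Small enough that the leftover \<open>real (card I) * t\<^sup>2\<close> is
      below 1, contradicting the unit total.\<close>
    define t where "t = 1 / (real (card I) + 1)"
    have "0 < t"
      by (simp add: t_def)
    have "1 = (\<Sum>i\<in>I. expectation (\<lambda>\<omega>. (\<xi> i \<omega>)\<^sup>2))"
      using one by simp
    also have "\<dots> \<le> (\<Sum>i\<in>I. expectation (\<lambda>\<omega>. ?P i \<omega> + ?Q i \<omega> / t + t\<^sup>2))"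
      using sq intP intQ
      by (intro sum_mono integral_mono square_le_truncated_moments \<open>0 < t\<close>) auto
    also have "\<dots> = (\<Sum>i\<in>I. expectation (?P i) + expectation (?Q i) / t + t\<^sup>2)"
      using intP intQ by (intro sum.cong) (auto simp: prob_space)
    also have "\<dots> = \<beta>2 + \<beta>3 / t + real (card I) * t\<^sup>2"
      by (simp add: sum.distrib \<beta>2_def \<beta>3_def sum_divide_distrib)
    also have "\<dots> < 1"
    proof -
      have "real (card I) < (real (card I) + 1)\<^sup>2"
        using zero_le_power2[of "real (card I)"] by (simp add: power2_sum add_strict_increasing2)
      then show ?thesis
        by (simp add: zero t_def power_divide)
    qed
    finally show False by simp
  qed
  define \<delta> where "\<delta> = (\<beta>2 + \<beta>3) / 4"
  have "0 < \<delta>"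
    using pos by (simp add: \<delta>_def)
  \<comment> \<open>Here \<open>16 * \<delta> = 4 * (\<beta>2 + \<beta>3)\<close>. Clearing
    denominators reduces the claim to
    \<open>(\<beta>2 + \<beta>3) * \<beta>2 \<le> \<beta>2 / 2\<close>.\<close>
  have "1 / 4 \<le> (1 - \<beta>2) / 2 - \<beta>3 / (16 * \<delta>)"
  proof -
    have "(\<beta>2 + \<beta>3) * \<beta>2 \<le> 1 / 2 * \<beta>2"
      using le \<beta>_nonneg by (intro mult_right_mono) auto
    then show ?thesis
      using pos unfolding \<delta>_def by (simp add: field_simps)
  qed
  also have "\<dots> = (\<Sum>i\<in>I. (expectation (\<lambda>\<omega>. (\<xi> i \<omega>)\<^sup>2) - expectation (?P i)) / 2 - expectation (?Q i) / (16 * \<delta>))"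
    by (simp add: sum_subtractf sum_divide_distrib[symmetric] one \<beta>2_def \<beta>3_def)
  also have "\<dots> = (\<Sum>i\<in>I. expectation (\<lambda>\<omega>. ((\<xi> i \<omega>)\<^sup>2 - ?P i \<omega>) / 2 - ?Q i \<omega> / (16 * \<delta>)))"
    using sq intP intQ by (intro sum.cong) auto
  also have "\<dots> \<le> (\<Sum>i\<in>I. expectation (\<lambda>\<omega>. \<bar>trunc1 (\<xi> i \<omega>)\<bar> * min \<delta> (\<bar>\<xi> i \<omega>\<bar> / 2)))"
  proof (intro sum_mono integral_mono abs_trunc1_mult_min_ge \<open>0 < \<delta>\<close>)
    fix i assume i: "i \<in> I"
    show "integrable M (\<lambda>\<omega>. ((\<xi> i \<omega>)\<^sup>2 - ?P i \<omega>) / 2 - ?Q i \<omega> / (16 * \<delta>))"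
      using sq intP intQ i by auto
    show "integrable M (\<lambda>\<omega>. \<bar>trunc1 (\<xi> i \<omega>)\<bar> * min \<delta> (\<bar>\<xi> i \<omega>\<bar> / 2))"
    proof (rule integrable_const_bound[of _ \<delta>])
      have "\<bar>\<bar>trunc1 x\<bar> * min \<delta> (\<bar>x\<bar> / 2)\<bar> \<le> 1 * \<delta>" for x
        unfolding abs_mult using \<open>0 < \<delta>\<close> by (intro mult_mono) (auto simp: abs_trunc1_le_1)
      then show "AE \<omega> in M. norm (\<bar>trunc1 (\<xi> i \<omega>)\<bar> * min \<delta> (\<bar>\<xi> i \<omega>\<bar> / 2)) \<le> \<delta>"
        by simp
    qed (use i in measurable)
  qed
  finally show "1 / 4 \<le> (\<Sum>i\<in>I. expectation (\<lambda>\<omega>. \<bar>trunc1 (\<xi> i \<omega>)\<bar> * min ((\<beta>2 + \<beta>3) / 4) (\<bar>\<xi> i \<omega>\<bar> / 2)))"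
    by (simp add: \<delta>_def)
qed

theorem lemmaB1:
  fixes M :: "'a measure" and n :: nat
    and \<xi> \<xi>b :: "nat \<Rightarrow> 'a \<Rightarrow> real"
    and W Wb :: "'a \<Rightarrow> real"
    and W' Wb' :: "nat \<Rightarrow> 'a \<Rightarrow> real"
    and \<beta>2 \<beta>3 :: real
  assumes "prob_space M"
    and "prob_space.indep_vars M (\<lambda>_. borel) \<xi> {1..n}"
    and "\<And>i. i \<in> {1..n} \<Longrightarrow> integrable M (\<lambda>\<omega>. (\<xi> i \<omega>)\<^sup>2)"
    and "\<And>i. i \<in> {1..n} \<Longrightarrow> (\<integral>\<omega>. \<xi> i \<omega> \<partial>M) = 0"
    and "\<xi>b = (\<lambda>i \<omega>. trunc1 (\<xi> i \<omega>))"
    and "W = (\<lambda>\<omega>. \<Sum>i=1..n. \<xi> i \<omega>)"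
    and "Wb = (\<lambda>\<omega>. \<Sum>i=1..n. \<xi>b i \<omega>)"
    and "W' = (\<lambda>i \<omega>. W \<omega> - \<xi> i \<omega>)"
    and "Wb' = (\<lambda>i \<omega>. Wb \<omega> - \<xi>b i \<omega>)"
    and "\<beta>2 = (\<Sum>i=1..n. \<integral>\<omega>. (\<xi> i \<omega>)\<^sup>2 * of_bool (\<bar>\<xi> i \<omega>\<bar> > 1) \<partial>M)"
    and "\<beta>3 = (\<Sum>i=1..n. \<integral>\<omega>. \<bar>\<xi> i \<omega>\<bar> ^ 3 * of_bool (\<bar>\<xi> i \<omega>\<bar> \<le> 1) \<partial>M)"
  shows
    "(\<forall>(\<Delta>1 :: 'a \<Rightarrow> real) (\<Delta>2 :: 'a \<Rightarrow> real)
       (\<Delta>1' :: nat \<Rightarrow> 'a \<Rightarrow> real) (\<Delta>2' :: nat \<Rightarrow> 'a \<Rightarrow> real)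
       (c1 :: real) (c2 :: real) (\<delta> :: real) (lam :: real).
        \<Delta>1 \<in> borel_measurable M \<and> \<Delta>2 \<in> borel_measurable M \<and>
        c1 > c2 \<and> c2 > 0 \<and> \<delta> \<in> {0<..<1/2} \<and>
        (\<Sum>i=1..n. \<integral>\<omega>. (\<xi> i \<omega>)\<^sup>2 \<partial>M) \<le> c1 \<and>
        (\<Sum>i=1..n. \<integral>\<omega>. \<bar>\<xi>b i \<omega>\<bar> * min \<delta> (\<bar>\<xi> i \<omega>\<bar> / 2) \<partial>M) \<ge> c2 \<and>
        (\<forall>i\<in>{1..n}. \<Delta>1' i \<in> borel_measurable M \<and> \<Delta>2' i \<in> borel_measurable M \<and>
           indep_rv M borel (\<xi> i)
             borel (\<lambda>\<omega>. (\<Delta>1' i \<omega>, \<Delta>2' i \<omega>, W' i \<omega>, Wb' i \<omega>))) \<and>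
        lam \<ge> 0
      \<longrightarrow>
        nn_expectation M (\<lambda>\<omega>. exp (lam * Wb \<omega>) * of_bool (\<Delta>1 \<omega> \<le> Wb \<omega> \<and> Wb \<omega> \<le> \<Delta>2 \<omega>))
        \<le> ennreal (sqrt (\<integral>\<omega>. exp (2 * lam * Wb \<omega>) \<partial>M) * exp (- (c2\<^sup>2 / (16 * c1 * \<delta>\<^sup>2))))
          + ennreal (2 * exp (lam * \<delta>) / c2) *
            ((\<Sum>i=1..n. nn_expectation M (\<lambda>\<omega>. \<bar>\<xi>b i \<omega>\<bar> * exp (lam * Wb' i \<omega>) *
                 (\<bar>\<Delta>1 \<omega> - \<Delta>1' i \<omega>\<bar> + \<bar>\<Delta>2 \<omega> - \<Delta>2' i \<omega>\<bar>)))
             + nn_expectation M (\<lambda>\<omega>. \<bar>Wb \<omega>\<bar> * exp (lam * Wb \<omega>) * (\<bar>\<Delta>2 \<omega> - \<Delta>1 \<omega>\<bar> + 2 * \<delta>))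
             + (\<Sum>i=1..n. ennreal \<bar>\<integral>\<omega>. \<xi>b i \<omega> \<partial>M\<bar> *
                 nn_expectation M (\<lambda>\<omega>. exp (lam * Wb' i \<omega>) *
                   (\<bar>\<Delta>2' i \<omega> - \<Delta>1' i \<omega>\<bar> + 2 * \<delta>)))))
     \<and>
     ((\<Sum>i=1..n. \<integral>\<omega>. (\<xi> i \<omega>)\<^sup>2 \<partial>M) = 1 \<and> \<beta>2 + \<beta>3 \<le> 1/2
      \<longrightarrow>
        (let \<delta> = (\<beta>2 + \<beta>3) / 4; c1 = (1::real); c2 = (1/4::real) in
          c1 > c2 \<and> c2 > 0 \<and> \<delta> \<in> {0<..<1/2} \<and>
          (\<Sum>i=1..n. \<integral>\<omega>. (\<xi> i \<omega>)\<^sup>2 \<partial>M) \<le> c1 \<and>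
          (\<Sum>i=1..n. \<integral>\<omega>. \<bar>\<xi>b i \<omega>\<bar> * min \<delta> (\<bar>\<xi> i \<omega>\<bar> / 2) \<partial>M) \<ge> c2))"
proof -
  interpret prob_space M by fact
  have meas: "\<xi> i \<in> borel_measurable M" if "i \<in> {1..n}" for i
    using assms(2) that by (auto simp: indep_vars_def)
  note eqs = assms(5,7,9)
  show ?thesis (is "?A \<and> ?B")
  proof
    show ?A
    proof (intro allI impI, elim conjE)
      fix \<Delta>1 \<Delta>2 :: "'a \<Rightarrow> real" and \<Delta>1' \<Delta>2' :: "nat \<Rightarrow> 'a \<Rightarrow> real" and c1 c2 \<delta> lam :: real
      assume "\<Delta>1 \<in> borel_measurable M" "\<Delta>2 \<in> borel_measurable M" "c2 < c1" "0 < c2" "\<delta> \<in> {0<..<1/2}"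
        "(\<Sum>i=1..n. \<integral>\<omega>. (\<xi> i \<omega>)\<^sup>2 \<partial>M) \<le> c1"
        "c2 \<le> (\<Sum>i=1..n. \<integral>\<omega>. \<bar>\<xi>b i \<omega>\<bar> * min \<delta> (\<bar>\<xi> i \<omega>\<bar> / 2) \<partial>M)" "0 \<le> lam"
        "\<forall>i\<in>{1..n}. \<Delta>1' i \<in> borel_measurable M \<and> \<Delta>2' i \<in> borel_measurable M \<and>
           indep_rv M borel (\<xi> i) borel (\<lambda>\<omega>. (\<Delta>1' i \<omega>, \<Delta>2' i \<omega>, W' i \<omega>, Wb' i \<omega>))"
      then show "nn_expectation M (\<lambda>\<omega>. exp (lam * Wb \<omega>) * of_bool (\<Delta>1 \<omega> \<le> Wb \<omega> \<and> Wb \<omega> \<le> \<Delta>2 \<omega>))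
        \<le> ennreal (sqrt (\<integral>\<omega>. exp (2 * lam * Wb \<omega>) \<partial>M) * exp (- (c2\<^sup>2 / (16 * c1 * \<delta>\<^sup>2))))
          + ennreal (2 * exp (lam * \<delta>) / c2) *
            ((\<Sum>i=1..n. nn_expectation M (\<lambda>\<omega>. \<bar>\<xi>b i \<omega>\<bar> * exp (lam * Wb' i \<omega>) *
                 (\<bar>\<Delta>1 \<omega> - \<Delta>1' i \<omega>\<bar> + \<bar>\<Delta>2 \<omega> - \<Delta>2' i \<omega>\<bar>)))
             + nn_expectation M (\<lambda>\<omega>. \<bar>Wb \<omega>\<bar> * exp (lam * Wb \<omega>) * (\<bar>\<Delta>2 \<omega> - \<Delta>1 \<omega>\<bar> + 2 * \<delta>))
             + (\<Sum>i=1..n. ennreal \<bar>\<integral>\<omega>. \<xi>b i \<omega> \<partial>M\<bar> *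
                 nn_expectation M (\<lambda>\<omega>. exp (lam * Wb' i \<omega>) *
                   (\<bar>\<Delta>2' i \<omega> - \<Delta>1' i \<omega>\<bar> + 2 * \<delta>))))"
        using assms(2,3) unfolding eqs
        \<comment> \<open>\<open>W'\<close> occurs in the independence premise but not in the
          conclusion, so the goal does not determine it.\<close>
        by (intro randomized_concentration[where W' = W']) auto
    qed
    show ?B
      \<comment> \<open>Positivity of \<delta> is the first conclusion of this lemma; the bound on
        \<open>\<beta>2 + \<beta>3\<close> keeps \<delta> at most 1/8.\<close>
      using truncated_moments_choice[of "{1..n}" \<xi>, OF meas assms(3)]
      unfolding Let_def assms(5,10,11) by auto
  qed
qed

end
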